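(* For every nonnegative integer $n$, let $GG_1(n)$ denote the number of partitions of $n$ in which any two consecutive parts differ by at least $2$, and by at least $4$ if both are even. Let $GG'_{-1}(n)$ denote the number of signed partitions of $n$ in which the positive parts are even and differ pairwise by at least $4$, and the negative parts are odd, distinct and each at most $2\ell^+-1$, where $\ell^+$ is the number of positive parts. Then $GG'_{-1}(n)=GG_1(n)$ for all $n\ge 0$.
   Context: A partition of an integer $n$ is a finite nonincreasing sequence of positive integers (its parts) summing to $n$. A signed partition of an integer $n$ is a pair $(\pi,\nu)$ of ordinary partitions with $|\pi|-|\nu|=n$, where $|\cdot|$ denotes the sum of parts; the parts of $\pi$ are the positive parts and the parts of $\nu$ are the negative parts (their sizes). $\ell^+$ denotes the number of positive parts of a signed partition. *)

theory Defs
  imports Main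
begin

definition is_partition :: "nat list \<Rightarrow> bool" where
  "is_partition xs \<longleftrightarrow> sorted_wrt (\<ge>) xs \<and> (\<forall>x\<in>set xs. 0 < x)"

definition partitions_of :: "nat \<Rightarrow> nat list set" where
  "partitions_of n = {xs. is_partition xs \<and> sum_list xs = n}"

(* A pair (pi, nu): the entries of nu are the sizes of the negative parts. *)
definition signed_partitions_of :: "int \<Rightarrow> (nat list \<times> nat list) set" where
  "signed_partitions_of n =
     {(pi, nu). is_partition pi \<and> is_partition nu \<and> int (sum_list pi) - int (sum_list nu) = n}"

definition GG1 :: "nat \<Rightarrow> nat" where
  "GG1 n = card {xs \<in> partitions_of n.
     \<forall>i. Suc i < length xs \<longrightarrow>
       int (xs ! i) - int (xs ! Suc i) \<ge> 2 \<and>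
       (even (xs ! i) \<and> even (xs ! Suc i) \<longrightarrow> int (xs ! i) - int (xs ! Suc i) \<ge> 4)}"

(* The bound on the negative parts is stated over the integers, so that for no positive parts
   it reads x \<le> -1. The set is finite: with l positive parts, the positive parts sum to at least
   2 l^2 and the negative parts to at most l^2. *)
definition GG'_minus1 :: "int \<Rightarrow> nat" where
  "GG'_minus1 n = card {(pi, nu) \<in> signed_partitions_of n.
     (\<forall>x\<in>set pi. even x) \<and>
     (\<forall>i j. i < j \<and> j < length pi \<longrightarrow> int (pi ! i) - int (pi ! j) \<ge> 4) \<and>
     (\<forall>x\<in>set nu. odd x) \<and>
     distinct nu \<and>
     (\<forall>x\<in>set nu. int x \<le> 2 * int (length pi) - 1)}"

end

theory Submission
  imports Defs
begin

text \<open>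
  Both families are graded by the number \<open>l\<close> of (positive) parts, and both satisfy the same
  recursion in \<open>l\<close>. A partition with \<open>l + 1\<close> parts counted by \<open>GG1\<close> has smallest part
  \<open>2 a + 1\<close> or \<open>2 a + 2\<close>; removing it and subtracting \<open>2 a + 2\<close>, respectively \<open>2 a + 4\<close>, from
  the other parts leaves an arbitrary such partition with \<open>l\<close> parts. In a signed partition with
  \<open>l + 1\<close> positive parts the smallest one is \<open>2 a + 2\<close>; removing it, subtracting \<open>2 a + 4\<close> from
  the other positive parts, and deleting the negative part \<open>2 l + 1\<close> if it is present leaves an
  arbitrary such signed partition with \<open>l\<close> positive parts. Matching an odd smallest part with the
  presence of \<open>2 l + 1\<close>, the weight drops by the same amount on both sides.
\<close>

section \<open>Both families, graded by the number of parts\<close>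

definition gg_gap :: "nat \<Rightarrow> nat \<Rightarrow> bool" where
  "gg_gap x y \<longleftrightarrow> y + 2 \<le> x \<and> (even x \<and> even y \<longrightarrow> y + 4 \<le> x)"

definition gg_partitions :: "nat \<Rightarrow> nat list set" where
  "gg_partitions l = {xs. length xs = l \<and> sorted_wrt gg_gap xs \<and> (\<forall>x\<in>set xs. 0 < x)}"

text \<open>The bound \<open>x < 2 * l\<close> avoids the natural-number subtraction in 2l - 1,
  which truncates at l = 0; there it leaves only the empty list.\<close>

definition gg_signed :: "nat \<Rightarrow> (nat list \<times> nat list) set" where
  "gg_signed l = {(ps, ns). length ps = l \<and> sorted_wrt (\<lambda>x y. y + 4 \<le> x) ps \<and>
     (\<forall>x\<in>set ps. 0 < x \<and> even x) \<and> sorted_wrt (>) ns \<and> (\<forall>x\<in>set ns. odd x \<and> x < 2 * l)}"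

definition signed_weight :: "nat list \<times> nat list \<Rightarrow> int" where
  "signed_weight p = int (sum_list (fst p)) - int (sum_list (snd p))"

text \<open>Both shifts are even, so parities survive, and each sends 1 to the least part that may
  precede the new last one.\<close>

fun gg_extend :: "(nat \<times> bool) \<times> nat list \<Rightarrow> nat list" where
  "gg_extend ((a, b), xs) =
     map (\<lambda>x. x + (2 * a + (if b then 2 else 4))) xs @ [2 * a + (if b then 1 else 2)]"

fun signed_extend :: "(nat \<times> bool) \<times> nat list \<times> nat list \<Rightarrow> nat list \<times> nat list" where
  "signed_extend ((a, b), ps, ns) =
     (map (\<lambda>x. x + (2 * a + 4)) ps @ [2 * a + 2], if b then (2 * length ps + 1) # ns else ns)"

lemma sum_list_map_add_const:
  "sum_list (map (\<lambda>x. x + c) xs) = sum_list xs + length xs * (c :: nat)"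
  by (induction xs) auto

lemma map_add_sub_const:
  assumes "\<forall>x\<in>set xs. c \<le> x"
  shows "map (\<lambda>x. x + c) (map (\<lambda>x. x - (c :: nat)) xs) = xs"
  using assms by (induction xs) auto

lemma inj_map_add_const: "inj (map (\<lambda>x. x + (c :: nat)))"
  by (intro inj_mapI injI) simp

text \<open>Two steps give a difference of at least 2 + 2 = 4, so the parity clause holds
  automatically for the composite.\<close>

lemma transp_gg_gap: "transp gg_gap"
  by (rule transpI) (auto simp: gg_gap_def)

text \<open>With l the common length, changing \<open>b\<close> from false to true lowers both
  weights by 2l + 1: on the signed side by the new negative part, on the other because each of the l
  shifted parts loses 2 and the new last part loses 1.\<close>

lemma weight_extend:
  assumes "length xs = length ps" and "int (sum_list xs) = signed_weight (ps, ns)"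
  shows "signed_weight (signed_extend (ab, ps, ns)) = int (sum_list (gg_extend (ab, xs)))"
proof -
  obtain a b where "ab = (a, b)" by fastforce
  then show ?thesis
    using assms by (simp add: signed_weight_def sum_list_map_add_const algebra_simps)
qed

section \<open>The recursion in the number of parts\<close>

lemma bij_gg_extend: "bij_betw gg_extend (UNIV \<times> gg_partitions l) (gg_partitions (Suc l))"
proof (rule bij_betw_imageI)
  show "inj_on gg_extend (UNIV \<times> gg_partitions l)"
  proof (rule inj_onI)
    fix u v assume "gg_extend u = gg_extend v"
    moreover obtain a b xs a' b' xs' where uv: "u = ((a, b), xs)" "v = ((a', b'), xs')"
      by (metis prod.exhaust)
    ultimately have eq: "gg_extend ((a, b), xs) = gg_extend ((a', b'), xs')" by simp
    then have last: "2 * a + (if b then 1 else 2) = 2 * a' + (if b' then 1 else 2)"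
      by simp
    \<comment> \<open>The last entry is odd exactly when \<open>b\<close> holds.\<close>
    have "b = b'"
      using arg_cong[OF last, of even] by (auto split: if_splits)
    with last have "a = a'" by (auto split: if_splits)
    with eq \<open>b = b'\<close> have "map (\<lambda>x. x + (2 * a + (if b then 2 else 4))) xs
        = map (\<lambda>x. x + (2 * a + (if b then 2 else 4))) xs'"
      by simp
    then have "xs = xs'" by (rule injD[OF inj_map_add_const])
    with \<open>a = a'\<close> \<open>b = b'\<close> show "u = v" by (simp add: uv)
  qed
  show "gg_extend ` (UNIV \<times> gg_partitions l) = gg_partitions (Suc l)"
  proof (intro equalityI subsetI)
    fix ys assume "ys \<in> gg_extend ` (UNIV \<times> gg_partitions l)"
    then obtain a b xs where ys: "ys = gg_extend ((a, b), xs)" and xs: "xs \<in> gg_partitions l"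
      by auto
    have "sorted_wrt gg_gap (map (\<lambda>x. x + (2 * a + (if b then 2 else 4))) xs)"
      using xs unfolding sorted_wrt_map gg_partitions_def
      by (auto simp: gg_gap_def elim!: sorted_wrt_mono_rel[rotated])
    \<comment> \<open>If \<open>b\<close> holds, the last part is odd and the difference x + 1
      suffices. Otherwise the difference is x + 2, which falls below 4 only for x = 1, where the
      larger part is odd.\<close>
    moreover have "gg_gap (x + (2 * a + (if b then 2 else 4))) (2 * a + (if b then 1 else 2))"
      if "0 < x" for x
      using that by (cases "x = 1") (auto simp: gg_gap_def)
    ultimately show "ys \<in> gg_partitions (Suc l)"
      using xs by (auto simp: ys gg_partitions_def sorted_wrt_append)
  next
    fix ys assume ys: "ys \<in> gg_partitions (Suc l)"
    then obtain zs s where ys_eq: "ys = zs @ [s]"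
      by (cases ys rule: rev_cases) (auto simp: gg_partitions_def)
    define b where "b = odd s"
    \<comment> \<open>This one formula inverts both s = 2a + 1 and s = 2a + 2.\<close>
    define a where "a = (s - 1) div 2"
    define c where "c = 2 * a + (if b then 2 else 4)"
    have s: "s = 2 * a + (if b then 1 else 2)"
    proof -
      have "0 < s" using ys by (auto simp: ys_eq gg_partitions_def)
      then show ?thesis unfolding a_def b_def by simp presburger
    qed
    have gap: "gg_gap z s" if "z \<in> set zs" for z
      using ys that by (auto simp: ys_eq gg_partitions_def sorted_wrt_append)
    \<comment> \<open>Strictness keeps the shifted parts positive. For even \<open>s\<close> the gap
      alone gives only z \<ge> c; equality would put two even parts at distance 2.\<close>
    have c_less: "c < z" if "z \<in> set zs" for z
      using gap[OF that] s unfolding c_def gg_gap_def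
      by (cases b; cases "z = 2 * a + 4") auto
    have "sorted_wrt gg_gap (map (\<lambda>x. x - c) zs)"
    proof -
      have "even c" by (simp add: c_def)
      have "gg_gap (x - c) (y - c)" if "x \<in> set zs" "y \<in> set zs" "gg_gap x y" for x y
        using that c_less[OF that(1)] c_less[OF that(2)] \<open>even c\<close>
        by (auto simp: gg_gap_def)
      moreover have "sorted_wrt gg_gap zs"
        using ys by (auto simp: ys_eq gg_partitions_def sorted_wrt_append)
      ultimately show ?thesis
        unfolding sorted_wrt_map by (blast intro: sorted_wrt_mono_rel)
    qed
    then have "map (\<lambda>x. x - c) zs \<in> gg_partitions l"
      using ys c_less by (auto simp: ys_eq gg_partitions_def)
    moreover have "ys = gg_extend ((a, b), map (\<lambda>x. x - c) zs)"
    proof -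
      have "map (\<lambda>x. x + c) (map (\<lambda>x. x - c) zs) = zs"
        by (rule map_add_sub_const) (auto dest: c_less)
      then show ?thesis
        using s unfolding ys_eq gg_extend.simps c_def by metis
    qed
    ultimately show "ys \<in> gg_extend ` (UNIV \<times> gg_partitions l)" by blast
  qed
qed

text \<open>The smallest positive part determines \<open>a\<close>. Since 2l + 1 exceeds every
  negative part allowed with l positive parts, its presence records \<open>b\<close>.\<close>

lemma bij_signed_extend: "bij_betw signed_extend (UNIV \<times> gg_signed l) (gg_signed (Suc l))"
proof (rule bij_betw_imageI)
  show "inj_on signed_extend (UNIV \<times> gg_signed l)"
  proof (rule inj_onI)
    fix u v assume "signed_extend u = signed_extend v"
      and "u \<in> UNIV \<times> gg_signed l" "v \<in> UNIV \<times> gg_signed l"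
    moreover obtain a b ps ns a' b' ps' ns'
      where uv: "u = ((a, b), ps, ns)" "v = ((a', b'), ps', ns')"
      by (metis prod.exhaust)
    ultimately have eq: "signed_extend ((a, b), ps, ns) = signed_extend ((a', b'), ps', ns')"
      and mem: "(ps, ns) \<in> gg_signed l" "(ps', ns') \<in> gg_signed l"
      by auto
    from eq have "a = a'" by simp
    with eq have "map (\<lambda>x. x + (2 * a + 4)) ps = map (\<lambda>x. x + (2 * a + 4)) ps'"
      by simp
    then have "ps = ps'" by (rule injD[OF inj_map_add_const])
    have neg: "(if b then (2 * l + 1) # ns else ns) = (if b' then (2 * l + 1) # ns' else ns')"
    proof -
      have "length ps = l" "length ps' = l" using mem by (auto simp: gg_signed_def)
      then show ?thesis using arg_cong[OF eq, of snd] by (simp only: signed_extend.simps snd_conv)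
    qed
    have "2 * l + 1 \<notin> set ns" "2 * l + 1 \<notin> set ns'"
      using mem by (fastforce simp: gg_signed_def)+
    with neg have "b = b' \<and> ns = ns'" by (auto split: if_splits)
    with \<open>a = a'\<close> \<open>ps = ps'\<close> show "u = v" by (simp add: uv)
  qed
  show "signed_extend ` (UNIV \<times> gg_signed l) = gg_signed (Suc l)"
  proof (intro equalityI subsetI)
    fix p assume "p \<in> signed_extend ` (UNIV \<times> gg_signed l)"
    then obtain a b ps ns where "p = signed_extend ((a, b), ps, ns)" "(ps, ns) \<in> gg_signed l"
      by auto
    then show "p \<in> gg_signed (Suc l)"
      by (fastforce simp: gg_signed_def sorted_wrt_append sorted_wrt_map)
  next
    fix p assume p: "p \<in> gg_signed (Suc l)"
    then obtain qs s ms where p_eq: "p = (qs @ [s], ms)"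
      by (cases p; cases "fst p" rule: rev_cases) (auto simp: gg_signed_def)
    define a where "a = (s - 2) div 2"
    have "0 < s" "even s" using p by (auto simp: p_eq gg_signed_def)
    then have s: "s = 2 * a + 2" unfolding a_def by presburger
    define b where "b = (2 * l + 1 \<in> set ms)"
    define ns where "ns = (if b then tl ms else ms)"
    \<comment> \<open>The gap of 4 above s = 2a + 2 ensures that subtracting 2a + 4 leaves positive
      even parts.\<close>
    have qs: "2 * a + 6 \<le> x \<and> even x" if "x \<in> set qs" for x
      using p that by (auto simp: p_eq gg_signed_def sorted_wrt_append s)
    have ms: "odd x \<and> x \<le> 2 * l + 1" if "x \<in> set ms" for x
      using p that by (auto simp: p_eq gg_signed_def)
    have sorted_ms: "sorted_wrt (>) ms" and sorted_qs: "sorted_wrt (\<lambda>x y. y + 4 \<le> x) qs"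
      and len: "length qs = l"
      using p by (auto simp: p_eq gg_signed_def sorted_wrt_append)
    \<comment> \<open>The largest admissible value 2l + 1 can occur in a strictly decreasing list
      only as its head, so \<open>tl\<close> removes exactly it.\<close>
    have ms_eq: "ms = (if b then (2 * l + 1) # ns else ns)"
    proof (cases b)
      case True
      then obtain m ms' where m: "ms = m # ms'" "2 * l + 1 \<in> set (m # ms')"
        unfolding b_def by (cases ms) auto
      then have "m = 2 * l + 1" using sorted_ms ms[of m] by auto
      with m True show ?thesis by (simp add: ns_def)
    qed (simp add: ns_def)
    have "2 * l + 1 \<notin> set ns \<and> set ns \<subseteq> set ms \<and> sorted_wrt (>) ns"
    proof (cases b)
      case True
      then have "ms = (2 * l + 1) # ns" using ms_eq by simp
      then show ?thesis using sorted_ms by auto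
    next
      case False
      then show ?thesis using sorted_ms by (simp add: ns_def b_def)
    qed
    then have "2 * l + 1 \<notin> set ns" "set ns \<subseteq> set ms" "sorted_wrt (>) ns" by auto
    \<comment> \<open>Below the old bound only 2l + 1 and 2l have to be excluded: the first is
      absent, the second is even.\<close>
    then have ns: "odd x \<and> x < 2 * l" if "x \<in> set ns" for x
      using that ms[of x] by (cases "x = 2 * l + 1"; cases "x = 2 * l") auto
    have "sorted_wrt (\<lambda>x y. y + 4 \<le> x) (map (\<lambda>x. x - (2 * a + 4)) qs)"
      unfolding sorted_wrt_map
      by (rule sorted_wrt_mono_rel[OF _ sorted_qs]) (auto dest!: qs)
    then have "(map (\<lambda>x. x - (2 * a + 4)) qs, ns) \<in> gg_signed l"
      using \<open>sorted_wrt (>) ns\<close> ns len by (auto simp: gg_signed_def dest: qs)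
    moreover have "p = signed_extend ((a, b), map (\<lambda>x. x - (2 * a + 4)) qs, ns)"
    proof -
      have "map (\<lambda>x. x + (2 * a + 4)) (map (\<lambda>x. x - (2 * a + 4)) qs) = qs"
        by (rule map_add_sub_const) (auto dest: qs)
      then show ?thesis
        using s ms_eq len unfolding p_eq signed_extend.simps by simp
    qed
    ultimately show "p \<in> signed_extend ` (UNIV \<times> gg_signed l)" by blast
  qed
qed

section \<open>The bijection for a fixed number of parts\<close>

text \<open>By induction: undo \<open>gg_extend\<close>, apply the smaller bijection while keeping
  \<open>(a, b)\<close>, then apply \<open>signed_extend\<close>. The weight clause is carried along
  because \<open>weight_extend\<close> needs it for the smaller objects.\<close>

lemma ex_weight_preserving_bij:
  "\<exists>f. bij_betw f (gg_partitions l) (gg_signed l) \<and>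
       (\<forall>xs\<in>gg_partitions l. signed_weight (f xs) = int (sum_list xs))"
proof (induction l)
  case 0
  have "gg_partitions 0 = {[]}" "gg_signed 0 = {([], [])}"
    by (auto simp: gg_partitions_def gg_signed_def)
  then show ?case
    by (intro exI[of _ "\<lambda>_. ([], [])"]) (simp add: bij_betw_def signed_weight_def)
next
  case (Suc l)
  then obtain f where f: "bij_betw f (gg_partitions l) (gg_signed l)"
    and weight: "\<And>xs. xs \<in> gg_partitions l \<Longrightarrow> signed_weight (f xs) = int (sum_list xs)"
    by blast
  define g where "g = inv_into (UNIV \<times> gg_partitions l) gg_extend"
  let ?h = "signed_extend \<circ> (map_prod id f \<circ> g)"
  have "bij_betw (map_prod id f) (UNIV \<times> gg_partitions l) (UNIV \<times> gg_signed l)"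
    by (rule bij_betw_map_prod) (use f in auto)
  then have "bij_betw ?h (gg_partitions (Suc l)) (gg_signed (Suc l))"
    unfolding g_def
    by (rule bij_betw_trans[OF bij_betw_trans[OF bij_betw_inv_into[OF bij_gg_extend]]
        bij_signed_extend])
  moreover have "signed_weight (?h ys) = int (sum_list ys)" if "ys \<in> gg_partitions (Suc l)" for ys
  proof -
    obtain ab xs where xs: "xs \<in> gg_partitions l" and ys: "ys = gg_extend (ab, xs)"
      using \<open>ys \<in> gg_partitions (Suc l)\<close> bij_gg_extend[of l] unfolding bij_betw_def by blast
    have "g ys = (ab, xs)"
      unfolding g_def ys using xs bij_gg_extend[of l]
      by (intro inv_into_f_f) (auto simp: bij_betw_def)
    moreover obtain ps ns where fx: "f xs = (ps, ns)" by fastforce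
    moreover have "length xs = length ps"
      using bij_betwE[OF f] xs fx by (fastforce simp: gg_partitions_def gg_signed_def)
    ultimately show ?thesis
      using weight_extend[of xs ps ns ab] weight[OF xs] ys by simp
  qed
  ultimately show ?case by blast
qed

section \<open>Translation of the counts and the union over all lengths\<close>

text \<open>Transitivity of \<open>gg_gap\<close> turns the condition on consecutive parts into one
  on all pairs, and this already forces the list to be nonincreasing.\<close>

lemma GG1_eq: "GG1 n = card {xs. xs \<in> gg_partitions (length xs) \<and> sum_list xs = n}"
proof -
  have gap: "(int x - int y \<ge> 2 \<and> (even x \<and> even y \<longrightarrow> int x - int y \<ge> 4)) = gg_gap x y"
    for x y :: nat
    by (auto simp: gg_gap_def)
  have "sorted_wrt (\<ge>) xs" if "sorted_wrt gg_gap xs" for xs :: "nat list"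
    using that by (rule sorted_wrt_mono_rel[rotated]) (auto simp: gg_gap_def)
  then show ?thesis
    unfolding GG1_def gap sorted_wrt_iff_nth_Suc_transp[OF transp_gg_gap, symmetric]
    by (auto simp: partitions_of_def is_partition_def gg_partitions_def intro!: arg_cong[of _ _ card])
qed

lemma GG'_minus1_eq:
  "GG'_minus1 n = card {p. p \<in> gg_signed (length (fst p)) \<and> signed_weight p = n}"
proof -
  have gap: "(\<forall>i j. i < j \<and> j < length ps \<longrightarrow> int (ps ! i) - int (ps ! j) \<ge> 4)
      \<longleftrightarrow> sorted_wrt (\<lambda>x y. y + 4 \<le> x) ps" for ps :: "nat list"
    by (auto simp: sorted_wrt_iff_nth_less) force+
  have desc: "sorted_wrt (\<ge>) ps" if "sorted_wrt (\<lambda>x y. y + 4 \<le> x) ps" for ps :: "nat list"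
    using that by (rule sorted_wrt_mono_rel[rotated]) auto
  have strict: "sorted_wrt (\<ge>) ns \<and> distinct ns \<longleftrightarrow> sorted_wrt (>) ns" for ns :: "nat list"
    by (induction ns) (auto simp: less_le)
  have bound: "int x \<le> 2 * int m - 1 \<longleftrightarrow> x < 2 * m" for x m :: nat
    by linarith
  have "(case p of (pi, nu) \<Rightarrow> (pi, nu) \<in> signed_partitions_of n \<and>
     (\<forall>x\<in>set pi. even x) \<and>
     (\<forall>i j. i < j \<and> j < length pi \<longrightarrow> int (pi ! i) - int (pi ! j) \<ge> 4) \<and>
     (\<forall>x\<in>set nu. odd x) \<and>
     distinct nu \<and>
     (\<forall>x\<in>set nu. int x \<le> 2 * int (length pi) - 1))
    \<longleftrightarrow> p \<in> gg_signed (length (fst p)) \<and> signed_weight p = n" for p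
  proof (cases p)
    case (Pair ps ns)
    \<comment> \<open>Positivity of the negative parts, absent from \<open>gg_signed\<close>, is
      recovered from their oddness.\<close>
    have pos: "0 < x" if "\<forall>x\<in>set ns. odd x \<and> x < m" "x \<in> set ns" for x m
      using that by (auto intro: odd_pos)
    show ?thesis
      unfolding Pair gap bound gg_signed_def signed_partitions_of_def is_partition_def
        signed_weight_def mem_Collect_eq prod.case fst_conv snd_conv
        strict[of ns, symmetric]
      using desc[of ps] by (auto dest: pos)
  qed
  then show ?thesis
    unfolding GG'_minus1_def by (intro arg_cong[of _ _ card] Collect_cong) auto
qed

theorem theorem4p2:
  fixes n :: nat
  shows "GG'_minus1 (int n) = GG1 n"
proof -
  obtain F where F: "\<And>l. bij_betw (F l) (gg_partitions l) (gg_signed l)"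
    and weight: "\<And>l xs. xs \<in> gg_partitions l \<Longrightarrow> signed_weight (F l xs) = int (sum_list xs)"
    using ex_weight_preserving_bij by metis
  define f where "f xs = F (length xs) xs" for xs
  \<comment> \<open>The number of positive parts of an image reveals the length of its source, so
    bijections for different lengths have disjoint images and glue to the injective
    \<open>f\<close>.\<close>
  have len: "length (fst (F l xs)) = l" if "xs \<in> gg_partitions l" for l xs
    using bij_betwE[OF F] that by (fastforce simp: gg_signed_def)
  have "bij_betw f {xs. xs \<in> gg_partitions (length xs) \<and> sum_list xs = n}
    {p. p \<in> gg_signed (length (fst p)) \<and> signed_weight p = int n}" (is "bij_betw f ?A ?B")
  proof (rule bij_betw_imageI)
    show "inj_on f ?A"
    proof (rule inj_onI)
      fix xs ys assume xs: "xs \<in> ?A" and ys: "ys \<in> ?A" and eq: "f xs = f ys"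
      have "length xs = length ys"
        using xs ys eq len unfolding f_def by (metis (mono_tags, lifting) mem_Collect_eq)
      then show "xs = ys"
        using xs ys eq bij_betw_imp_inj_on[OF F] unfolding f_def
        by (auto dest: inj_onD)
    qed
    show "f ` ?A = ?B"
    proof (intro equalityI subsetI)
      fix p assume "p \<in> f ` ?A"
      then show "p \<in> ?B"
        using bij_betwE[OF F] by (auto simp: f_def len weight)
    next
      fix p assume p: "p \<in> ?B"
      then obtain xs where xs: "xs \<in> gg_partitions (length (fst p))" "p = F (length (fst p)) xs"
        using bij_betw_imp_surj_on[OF F[of "length (fst p)"]] by blast
      then have "length xs = length (fst p)" by (simp add: gg_partitions_def)
      moreover from this xs have "p = f xs" unfolding f_def by simp
      moreover have "sum_list xs = n" using weight[OF xs(1)] xs(2) p by simp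
      ultimately have "xs \<in> ?A" "p = f xs" using xs(1) by simp_all
      then show "p \<in> f ` ?A" by blast
    qed
  qed
  then show ?thesis
    unfolding GG1_eq GG'_minus1_eq by (rule bij_betw_same_card[symmetric])
qed

end
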